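(* Let $\mathbf P,\mathbf Q$ be probability measures on the subsets of $\mathcal N_o$ such that $$\mathbf P[N(o)\cap A\neq\emptyset]<\mathbf Q[N(o)\cap A\neq\emptyset]\qquad\text{for all }\emptyset\subsetneq A\subsetneq\mathcal N_o,$$ and assume $\mathbb Q[o\rightsquigarrow\infty]=0$. Then there is a constant $c>0$ such that $\mathbb P[o\rightsquigarrow\partial B_n]\le e^{-cn}$ for all $n\in\mathbb N$.
   Context: Work on $\mathbb Z^d$, $d\ge1$, with origin $o$. For $u\in\mathbb Z^d$ let $\mathcal N_u=\{v:\|u-v\|_1=1\}$. For a probability measure $\mathbf P$ on the subsets of $\mathcal N_o$, $N(o)$ denotes a random subset with law $\mathbf P$. The product measure $\mathbb P$ (resp. $\mathbb Q$) is the law of independent $(N(u))_{u\in\mathbb Z^d}$, $N(u)\subseteq\mathcal N_u$, with $\{x-u:x\in N(u)\}\sim\mathbf P$ (resp. $\mathbf Q$). Consider the directed graph with edges $(u,v)$, $v\in N(u)$. $B_n=\{x:\|x\|_1\le n\}$, $\partial B_n=B_{n+1}\setminus B_n$. $\{o\rightsquigarrow\partial B_n\}$ is the event that a directed path from $o$ reaches $\partial B_n$; $\{o\rightsquigarrow\infty\}$ is the event that the set of vertices reachable from $o$ by directed paths is infinite. *)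

theory Defs
  imports "HOL-Probability.Probability"
begin

text \<open>The lattice Z^d is modelled as int^'d for a finite index type 'd (so d = CARD('d) \<ge> 1);
  the origin o is 0.\<close>

definition norm1 :: "int ^ 'd \<Rightarrow> int" where
  "norm1 x = (\<Sum>i\<in>UNIV. \<bar>x $ i\<bar>)"

definition nbrs :: "int ^ 'd \<Rightarrow> (int ^ 'd) set" where
  "nbrs u = {v. norm1 (u - v) = 1}"

definition config_measure :: "(int ^ 'd) set pmf \<Rightarrow> (int ^ 'd \<Rightarrow> (int ^ 'd) set) measure" where
  "config_measure P = (\<Pi>\<^sub>M u\<in>UNIV. measure_pmf (map_pmf (\<lambda>S. (\<lambda>x. u + x) ` S) P))"

definition edges :: "(int ^ 'd \<Rightarrow> (int ^ 'd) set) \<Rightarrow> ((int ^ 'd) \<times> (int ^ 'd)) set" where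
  "edges \<omega> = {(u, v). v \<in> \<omega> u}"

definition reachable :: "(int ^ 'd \<Rightarrow> (int ^ 'd) set) \<Rightarrow> (int ^ 'd) set" where
  "reachable \<omega> = {v. (0, v) \<in> (edges \<omega>)\<^sup>*}"

definition ball1 :: "nat \<Rightarrow> (int ^ 'd) set" where
  "ball1 n = {x. norm1 x \<le> int n}"

definition bdry :: "nat \<Rightarrow> (int ^ 'd) set" where
  "bdry n = ball1 (Suc n) - ball1 n"

definition reaches_bdry :: "nat \<Rightarrow> (int ^ 'd \<Rightarrow> (int ^ 'd) set) set" where
  "reaches_bdry n = {\<omega>. reachable \<omega> \<inter> bdry n \<noteq> {}}"

definition percolates :: "(int ^ 'd \<Rightarrow> (int ^ 'd) set) set" where
  "percolates = {\<omega>. infinite (reachable \<omega>)}"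

end

theory Submission
  imports Defs
begin

text \<open>Let \<open>C\<close> be the set of vertices reached from \<open>o\<close>. Since \<open>C\<close> is \<open>Q\<close>-almost surely finite, weighting
  \<open>Q\<close> by \<open>exp (- h |C|)\<close> with a small \<open>h\<close> changes the local hitting probabilities, conditionally on
  any explored part of \<open>C\<close>, by a factor close to 1 only: adding the vertices \<open>u + S\<close> to the explored
  set decreases the expected weight of the rest by a factor close to 1. Hence the weighted measure
  still has larger hitting probabilities than \<open>P\<close>, and exploring \<open>C\<close> vertex by vertex shows that the
  \<open>P\<close>-probability of hitting a target is at most the weighted \<open>Q\<close>-probability. The latter is
  exponentially small for the target \<open>\<partial>B\<^sub>n\<close>, because reaching it forces \<open>|C| > n\<close>. Only proper subsets
  of neighbours matter, since each vertex is entered from a neighbour that is already explored; to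
  make this true for the first vertex too, the exploration starts after the last visit to \<open>o\<close>.\<close>

section \<open>Clusters with forbidden vertices\<close>

text \<open>The vertices reached from \<open>R\<close> by paths avoiding \<open>E\<close>. During the exploration, \<open>E\<close> consists of the
  vertices whose outgoing edges have been revealed and of the complement of a finite box.\<close>

definition cluster :: "(int ^ 'd) set \<Rightarrow> (int ^ 'd) set \<Rightarrow> (int ^ 'd \<Rightarrow> (int ^ 'd) set) \<Rightarrow> (int ^ 'd) set" where
  "cluster E R \<omega> = {v. \<exists>r\<in>R - E. (r, v) \<in> (edges \<omega> \<inter> (- E) \<times> (- E))\<^sup>*}"

lemma cluster_base: "r \<in> R \<Longrightarrow> r \<notin> E \<Longrightarrow> r \<in> cluster E R \<omega>"
  by (auto simp: cluster_def)

lemma cluster_extend: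
  assumes "v \<in> cluster E R \<omega>" "v \<notin> E" "w \<in> \<omega> v" "w \<notin> E"
  shows "w \<in> cluster E R \<omega>"
proof -
  have "(v, w) \<in> edges \<omega> \<inter> (- E) \<times> (- E)" using assms by (auto simp: edges_def)
  then show ?thesis using assms(1) by (auto simp: cluster_def intro: rtrancl_into_rtrancl)
qed

lemma cluster_induct [consumes 1, case_names base step]:
  assumes "v \<in> cluster E R \<omega>"
    and base: "\<And>r. r \<in> R \<Longrightarrow> r \<notin> E \<Longrightarrow> Pr r"
    and step: "\<And>v w. v \<in> cluster E R \<omega> \<Longrightarrow> v \<notin> E \<Longrightarrow> w \<in> \<omega> v \<Longrightarrow> w \<notin> E \<Longrightarrow> Pr v \<Longrightarrow> Pr w"
  shows "Pr v"
proof -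
  obtain r where r: "r \<in> R" "r \<notin> E" and path: "(r, v) \<in> (edges \<omega> \<inter> (- E) \<times> (- E))\<^sup>*"
    using assms(1) by (auto simp: cluster_def)
  from path show ?thesis
  proof (induction rule: rtrancl_induct)
    case base
    show ?case using assms(2) r by blast
  next
    case (step y z)
    have "y \<in> cluster E R \<omega>" using step.hyps(1) r by (auto simp: cluster_def)
    then show ?case using step assms(3)[of y z] by (auto simp: edges_def)
  qed
qed

lemma cluster_disjoint: "v \<in> cluster E R \<omega> \<Longrightarrow> v \<notin> E"
  by (induction rule: cluster_induct) auto

lemma cluster_subset: "cluster E R \<omega> \<subseteq> - E"
  using cluster_disjoint by blast

lemma cluster_mono:
  assumes "R \<subseteq> R'" "E' \<subseteq> E"
  shows "cluster E R \<omega> \<subseteq> cluster E' R' \<omega>"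
proof
  fix v assume "v \<in> cluster E R \<omega>"
  then show "v \<in> cluster E' R' \<omega>"
  proof (induction rule: cluster_induct)
    case (base r)
    then show ?case using assms by (auto intro: cluster_base)
  next
    case (step v w)
    then show ?case using assms by (blast intro: cluster_extend)
  qed
qed

lemma cluster_Un: "cluster E (R \<union> B) \<omega> = cluster E R \<omega> \<union> cluster E B \<omega>"
  by (auto simp: cluster_def)

lemma cluster_empty: "R \<subseteq> E \<Longrightarrow> cluster E R \<omega> = {}"
  by (auto simp: cluster_def)

lemma cluster_upd:
  assumes "u \<in> E"
  shows "cluster E R (fun_upd \<omega> u S) = cluster E R \<omega>"
proof -
  have "edges (fun_upd \<omega> u S) \<inter> (- E) \<times> (- E) = edges \<omega> \<inter> (- E) \<times> (- E)"
    using assms by (auto simp: edges_def split: if_splits)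
  then show ?thesis by (simp add: cluster_def)
qed

text \<open>One step of the exploration: a path that visits \<open>u\<close> can be cut after its
  last visit, and what follows starts at an out-neighbour of \<open>u\<close> and avoids
  \<open>u\<close>. The explored vertex stays in the root set, where it later serves as the explored
  neighbour of newly found vertices.\<close>

lemma cluster_step:
  assumes "u \<in> R" "u \<notin> E"
  shows "cluster E R \<omega> = insert u (cluster (insert u E) (R \<union> \<omega> u) \<omega>)"
proof (intro equalityI subsetI)
  fix v assume "v \<in> cluster E R \<omega>"
  then show "v \<in> insert u (cluster (insert u E) (R \<union> \<omega> u) \<omega>)"
  proof (induction rule: cluster_induct)
    case (base r)
    then show ?case by (auto intro: cluster_base)
  next
    case (step v w)
    then show ?case
      by (cases "w = u"; cases "v = u") (auto intro: cluster_base cluster_extend)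
  qed
next
  fix v assume v: "v \<in> insert u (cluster (insert u E) (R \<union> \<omega> u) \<omega>)"
  have u: "u \<in> cluster E R \<omega>" using assms by (simp add: cluster_base)
  have "x \<in> cluster E R \<omega>" if "x \<in> cluster (insert u E) (R \<union> \<omega> u) \<omega>" for x
    using that
  proof (induction rule: cluster_induct)
    case (base r)
    then show ?case using u assms by (auto intro: cluster_base cluster_extend)
  next
    case (step v w)
    then show ?case by (auto intro: cluster_extend)
  qed
  then show "v \<in> cluster E R \<omega>" using u v by auto
qed

lemma reachable_eq_cluster: "reachable \<omega> = cluster {} {0} \<omega>"
  by (auto simp: reachable_def cluster_def)

text \<open>Recentring the configuration at \<open>b\<close> turns the cluster of \<open>b\<close>
  into a cluster of the origin, so that translation invariance applies.\<close>

lemma cluster_translate: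
  fixes b :: "int ^ 'd"
  shows "cluster {} {b} \<omega> = (+) b ` cluster {} {0} (\<lambda>u. (\<lambda>x. x - b) ` \<omega> (b + u))"
    (is "_ = (+) b ` cluster {} {0} ?\<omega>")
proof (intro equalityI subsetI)
  fix v assume "v \<in> cluster {} {b} \<omega>"
  then have "v - b \<in> cluster {} {0} ?\<omega>"
  proof (induction rule: cluster_induct)
    case (base r)
    then show ?case by (auto intro: cluster_base)
  next
    case (step v w)
    then show ?case by (auto intro!: cluster_extend[of "v - b" _ _ _ "w - b"])
  qed
  then have "b + (v - b) \<in> (+) b ` cluster {} {0} ?\<omega>" by blast
  then show "v \<in> (+) b ` cluster {} {0} ?\<omega>" by simp
next
  fix v assume "v \<in> (+) b ` cluster {} {0} ?\<omega>"
  then obtain x where x: "x \<in> cluster {} {0} ?\<omega>" and v: "v = b + x" by blast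
  from x have "b + x \<in> cluster {} {b} \<omega>"
  proof (induction rule: cluster_induct)
    case (base r)
    then show ?case by (auto intro: cluster_base)
  next
    case (step v w)
    then show ?case by (auto intro: cluster_extend)
  qed
  then show "v \<in> cluster {} {b} \<omega>" by (simp add: v)
qed

subsection \<open>The product measure\<close>

abbreviation local_law :: "(int ^ 'd) set pmf \<Rightarrow> int ^ 'd \<Rightarrow> (int ^ 'd) set measure" where
  "local_law P u \<equiv> measure_pmf (map_pmf (\<lambda>S. (\<lambda>x. u + x) ` S) P)"

lemma prob_space_config: "prob_space (config_measure P)"
  unfolding config_measure_def by (intro prob_space_PiM prob_space_measure_pmf)

lemma space_config [simp]: "space (config_measure P) = UNIV"
  by (auto simp: config_measure_def space_PiM)

lemma sets_config: "sets (config_measure P) = sets (\<Pi>\<^sub>M u\<in>UNIV. count_space UNIV)"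
  unfolding config_measure_def by (intro sets_PiM_cong) auto

lemma pred_config_component [measurable]: "Measurable.pred (config_measure P) (\<lambda>\<omega>. A (\<omega> u))"
proof -
  have "(\<lambda>\<omega>. \<omega> u) \<in> measurable (config_measure P) (count_space UNIV)"
    unfolding measurable_cong_sets[OF sets_config refl] by simp
  then show ?thesis by (rule measurable_compose) simp
qed

lemma pred_cluster [measurable]: "Measurable.pred (config_measure P) (\<lambda>\<omega>. v \<in> cluster E R \<omega>)"
proof -
  \<comment> \<open>Fixing the path length makes the reachability event a countable combination of
    coordinate events.\<close>
  have *: "Measurable.pred (config_measure P) (\<lambda>\<omega>. (r, v) \<in> (edges \<omega> \<inter> (- E) \<times> (- E)) ^^ n)" for r v n
  proof (induction n arbitrary: v)
    case 0
    show ?case by simp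
  next
    case (Suc n)
    have "((r, v) \<in> (edges \<omega> \<inter> (- E) \<times> (- E)) ^^ Suc n) \<longleftrightarrow>
        (\<exists>w. (r, w) \<in> (edges \<omega> \<inter> (- E) \<times> (- E)) ^^ n \<and> v \<in> \<omega> w \<and> w \<notin> E \<and> v \<notin> E)" for \<omega>
      by (auto simp: edges_def)
    then show ?case using Suc by simp
  qed
  have "v \<in> cluster E R \<omega> \<longleftrightarrow> (\<exists>r. r \<in> R - E \<and> (\<exists>n. (r, v) \<in> (edges \<omega> \<inter> (- E) \<times> (- E)) ^^ n))" for \<omega>
    by (auto simp: cluster_def rtrancl_power)
  then show ?thesis using * by simp
qed

text \<open>With a finite complement of \<open>E\<close> the cluster takes only finitely many
  values, so it suffices to measure the preimage of each single value.\<close>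

lemma measurable_cluster:
  assumes "finite (- E)"
  shows "cluster E R \<in> measurable (config_measure P) (count_space UNIV)"
proof -
  have "cluster E R \<in> measurable (config_measure P) (count_space (Pow (- E)))"
  proof (subst measurable_count_space_eq_countable)
    show "countable (Pow (- E))" using assms by (simp add: countable_finite)
    have "Measurable.pred (config_measure P) (\<lambda>\<omega>. \<forall>v. v \<in> cluster E R \<omega> \<longleftrightarrow> v \<in> A)" for A
      by measurable
    then have "{\<omega>. \<forall>v. v \<in> cluster E R \<omega> \<longleftrightarrow> v \<in> A} \<in> sets (config_measure P)" for A
      by (simp add: pred_def)
    moreover have "cluster E R -` {A} = {\<omega>. \<forall>v. v \<in> cluster E R \<omega> \<longleftrightarrow> v \<in> A}" for A
      by auto
    ultimately show "cluster E R \<in> space (config_measure P) \<rightarrow> Pow (- E) \<and>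
        (\<forall>A\<in>Pow (- E). cluster E R -` {A} \<inter> space (config_measure P) \<in> sets (config_measure P))"
      using cluster_disjoint by fastforce
  qed
  then show ?thesis by (rule measurable_compose) simp
qed

lemma borel_measurable_cluster:
  fixes f :: "(int ^ 'd) set \<Rightarrow> real"
  assumes "finite (- E)"
  shows "(\<lambda>\<omega>. f (cluster E R \<omega>)) \<in> borel_measurable (config_measure P)"
  by (rule measurable_compose[OF measurable_cluster[OF assms]]) simp

lemma integrable_cluster:
  fixes f :: "(int ^ 'd) set \<Rightarrow> real"
  assumes "finite (- E)"
  shows "integrable (config_measure P) (\<lambda>\<omega>. f (cluster E R \<omega>))"
proof -
  interpret prob_space "config_measure P" by (rule prob_space_config)
  have "\<bar>f (cluster E R \<omega>)\<bar> \<le> Max ((\<lambda>A. \<bar>f A\<bar>) ` Pow (- E))" for \<omega>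
    using assms by (intro Max_ge imageI) (auto dest: cluster_disjoint)
  then show ?thesis
    by (intro integrable_const_bound[OF AE_I2] borel_measurable_cluster assms) auto
qed

text \<open>Overwriting coordinate \<open>u\<close> by an independent sample of its law preserves a
  product measure; Fubini then separates the sample from the other coordinates.\<close>

lemma integral_config_resample:
  fixes f :: "(int ^ 'd \<Rightarrow> (int ^ 'd) set) \<Rightarrow> real"
  assumes f: "integrable (config_measure P) f"
  shows "(\<integral>\<omega>. f \<omega> \<partial>config_measure P) = (\<integral>S. (\<integral>\<omega>. f (fun_upd \<omega> u ((+) u ` S)) \<partial>config_measure P) \<partial>P)"
proof -
  let ?L = "local_law P u" and ?M = "config_measure P"
  interpret M: prob_space ?M by (rule prob_space_config)
  interpret L: prob_space ?L by (rule prob_space_measure_pmf)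
  interpret pair_sigma_finite ?L ?M ..
  have *: "distr (?L \<Otimes>\<^sub>M ?M) ?M (\<lambda>(x, X). fun_upd X u x) = ?M"
    using distr_pair_PiM_eq_PiM[of UNIV "local_law P" u]
    by (simp add: config_measure_def prob_space_measure_pmf)
  have meas: "(\<lambda>(x, X). fun_upd X u x) \<in> measurable (?L \<Otimes>\<^sub>M ?M) ?M"
    unfolding config_measure_def split_beta
    by (rule measurable_fun_upd[where J = UNIV]) (auto simp: measurable_pair_iff)
  have "(\<integral>\<omega>. f \<omega> \<partial>?M) = (\<integral>\<omega>. f \<omega> \<partial>distr (?L \<Otimes>\<^sub>M ?M) ?M (\<lambda>(x, X). fun_upd X u x))"
    by (simp add: *)
  also have "\<dots> = (\<integral>y. f (case y of (x, X) \<Rightarrow> fun_upd X u x) \<partial>(?L \<Otimes>\<^sub>M ?M))"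
    using f by (intro integral_distr meas) auto
  also have "\<dots> = (\<integral>x. \<integral>X. f (fun_upd X u x) \<partial>?M \<partial>?L)"
  proof (subst integral_fst'[symmetric])
    show "integrable (?L \<Otimes>\<^sub>M ?M) (\<lambda>y. f (case y of (x, X) \<Rightarrow> fun_upd X u x))"
      by (rule integrable_distr[OF meas]) (simp add: * f)
  qed simp
  also have "\<dots> = (\<integral>S. (\<integral>\<omega>. f (fun_upd \<omega> u ((+) u ` S)) \<partial>?M) \<partial>P)"
    by simp
  finally show ?thesis .
qed

text \<open>The engine of all inductions on \<open>card (- E)\<close>: by \<open>cluster_upd\<close>
  the remaining cluster ignores the resampled coordinate, so the inner integral is again over the
  full configuration measure.\<close>

lemma integral_cluster_step:
  fixes f :: "(int ^ 'd) set \<Rightarrow> real"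
  assumes "finite (- E)" "u \<in> R" "u \<notin> E"
  shows "(\<integral>\<omega>. f (cluster E R \<omega>) \<partial>config_measure P) =
    (\<integral>S. (\<integral>\<omega>. f (insert u (cluster (insert u E) (R \<union> (+) u ` S) \<omega>)) \<partial>config_measure P) \<partial>P)"
  by (subst integral_config_resample[OF integrable_cluster[OF assms(1)], of _ _ _ u],
      subst cluster_step[OF assms(2,3)])
    (simp add: cluster_upd)

text \<open>The configuration space admits arbitrary sets as values; the restriction to neighbours
  holds almost surely at each of countably many vertices.\<close>

lemma AE_config_nbrs:
  fixes P :: "(int ^ 'd) set pmf"
  assumes "set_pmf P \<subseteq> Pow (nbrs 0)"
  shows "AE \<omega> in config_measure P. \<forall>u. \<omega> u \<subseteq> nbrs u"
proof (subst AE_all_countable, rule allI)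
  fix u :: "int ^ 'd"
  have "AE T in local_law P u. T \<subseteq> nbrs u"
  proof (subst AE_measure_pmf_iff, rule ballI)
    fix T assume "T \<in> set_pmf (map_pmf (\<lambda>S. (\<lambda>x. u + x) ` S) P)"
    then obtain S where "S \<subseteq> nbrs 0" "T = (+) u ` S" using assms by auto
    moreover have "norm1 (- x) = norm1 x" for x :: "int ^ 'd" by (simp add: norm1_def)
    ultimately show "T \<subseteq> nbrs u" by (auto simp: nbrs_def)
  qed
  then show "AE \<omega> in config_measure P. \<omega> u \<subseteq> nbrs u"
    unfolding config_measure_def by (intro AE_PiM_component prob_space_measure_pmf) auto
qed


subsection \<open>Exponential weights\<close>

text \<open>The Laplace transform of the cluster size, that is, the normalising constant of the
  weighted measure.\<close>

definition weight :: "(int ^ 'd) set pmf \<Rightarrow> real \<Rightarrow> (int ^ 'd) set \<Rightarrow> (int ^ 'd) set \<Rightarrow> real" where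
  "weight Q h R E = (\<integral>\<omega>. exp (- h * real (card (cluster E R \<omega>))) \<partial>config_measure Q)"

definition hit :: "(int ^ 'd) set pmf \<Rightarrow> (int ^ 'd) set \<Rightarrow> (int ^ 'd) set \<Rightarrow> (int ^ 'd) set \<Rightarrow> real" where
  "hit P T R E = (\<integral>\<omega>. of_bool (cluster E R \<omega> \<inter> T \<noteq> {}) \<partial>config_measure P)"

text \<open>Left unnormalised so that one exploration step acts linearly; the quotient by
  \<open>weight\<close> is the hitting probability under the weighted measure.\<close>

definition hit_weight ::
  "(int ^ 'd) set pmf \<Rightarrow> real \<Rightarrow> (int ^ 'd) set \<Rightarrow> (int ^ 'd) set \<Rightarrow> (int ^ 'd) set \<Rightarrow> real" where
  "hit_weight Q h T R E = (\<integral>\<omega>. of_bool (cluster E R \<omega> \<inter> T \<noteq> {}) *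
     exp (- h * real (card (cluster E R \<omega>))) \<partial>config_measure Q)"

lemma weight_nonneg: "0 \<le> weight Q h R E"
  by (simp add: weight_def)

lemma weight_antimono:
  assumes "finite (- E)" "0 \<le> h" "R \<subseteq> R'"
  shows "weight Q h R' E \<le> weight Q h R E"
  unfolding weight_def
proof (intro integral_mono integrable_cluster[OF assms(1), where f = "\<lambda>C. exp (- h * real (card C))"])
  fix \<omega>
  have "card (cluster E R \<omega>) \<le> card (cluster E R' \<omega>)"
    using assms by (intro card_mono cluster_mono) (auto intro: finite_subset[OF cluster_subset])
  then show "exp (- h * real (card (cluster E R' \<omega>))) \<le> exp (- h * real (card (cluster E R \<omega>)))"
    using assms(2) by (simp add: mult_left_mono)
qed

lemma weight_empty: "R \<subseteq> E \<Longrightarrow> weight Q h R E = 1"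
  using prob_space.prob_space[OF prob_space_config[of Q]] by (simp add: weight_def cluster_empty)

lemma weight_le_1:
  assumes "finite (- E)" "0 \<le> h"
  shows "weight Q h R E \<le> 1"
  using weight_antimono[OF assms, of "{}" R Q] by (simp add: weight_empty)

lemma hit_bounds: "0 \<le> hit P T R E" "finite (- E) \<Longrightarrow> hit P T R E \<le> 1"
proof -
  interpret prob_space "config_measure P" by (rule prob_space_config)
  show "0 \<le> hit P T R E" by (simp add: hit_def)
  show "hit P T R E \<le> 1" if "finite (- E)"
    unfolding hit_def
    by (intro integral_le_const integrable_cluster[OF that, where f = "\<lambda>C. of_bool (C \<inter> T \<noteq> {})"]) auto
qed

lemma integrable_pmf_unit:
  fixes f :: "'a \<Rightarrow> real"
  assumes "\<And>x. 0 \<le> f x" "\<And>x. f x \<le> 1"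
  shows "integrable (measure_pmf p) f"
  using assms by (intro measure_pmf.integrable_const_bound[where B = 1]) auto

text \<open>The factor \<open>exp (- h)\<close> accounts for \<open>u\<close> itself, which the
  remaining cluster avoids.\<close>

lemma weight_step:
  fixes Q :: "(int ^ 'd) set pmf"
  assumes "finite (- E)" "u \<in> R" "u \<notin> E"
  shows "weight Q h R E = exp (- h) * (\<integral>S. weight Q h (R \<union> (+) u ` S) (insert u E) \<partial>Q)"
proof -
  have "finite (cluster (insert u E) X \<omega>)" for X \<omega>
    using assms(1) cluster_subset[of "insert u E" X \<omega>] by (rule_tac finite_subset) auto
  then have "card (insert u (cluster (insert u E) X \<omega>)) = Suc (card (cluster (insert u E) X \<omega>))" for X \<omega>
    using cluster_disjoint[of u "insert u E"] by (subst card_insert_disjoint) auto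
  then show ?thesis
    unfolding weight_def
    by (subst integral_cluster_step[OF assms, where f = "\<lambda>C. exp (- h * real (card C))"])
      (simp add: exp_diff exp_minus divide_inverse distrib_left mult.commute)
qed

text \<open>Explore the cluster of \<open>R\<close> first. Whatever it turns out to be, the
  additional vertices reached from \<open>B\<close> cost at most the factor \<open>b\<close>,
  because the bound on the weight of \<open>B\<close> is uniform in the forbidden set.\<close>

lemma weight_Un_ge:
  fixes Q :: "(int ^ 'd) set pmf"
  assumes "finite (- E)" "0 \<le> h" "0 \<le> b"
    and b: "\<And>F. finite (- F) \<Longrightarrow> b \<le> weight Q h B F"
  shows "b * weight Q h R E \<le> weight Q h (R \<union> B) E"
  using assms(1)
proof (induction "card (- E)" arbitrary: E R rule: less_induct)
  case less
  show ?case
  proof (cases "R \<subseteq> E")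
    case True
    then have "weight Q h (R \<union> B) E = weight Q h B E"
      by (simp add: weight_def cluster_Un cluster_empty)
    then show ?thesis using b less.prems True by (simp add: weight_empty)
  next
    case False
    then obtain u where u: "u \<in> R" "u \<notin> E" by blast
    have *: "- E = insert u (- insert u E)" using u by blast
    have fin: "finite (- insert u E)" using less.prems by (rule rev_finite_subset) auto
    have card: "card (- insert u E) < card (- E)"
      using less.prems u by (intro psubset_card_mono) auto
    have "b * (\<integral>S. weight Q h (R \<union> (+) u ` S) (insert u E) \<partial>Q)
        = (\<integral>S. b * weight Q h (R \<union> (+) u ` S) (insert u E) \<partial>Q)" by simp
    also have "\<dots> \<le> (\<integral>S. weight Q h (R \<union> B \<union> (+) u ` S) (insert u E) \<partial>Q)"
    proof (rule integral_mono)
      fix S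
      show "b * weight Q h (R \<union> (+) u ` S) (insert u E) \<le> weight Q h (R \<union> B \<union> (+) u ` S) (insert u E)"
        using less.hyps[OF card fin, of "R \<union> (+) u ` S"] by (simp add: Un_ac)
    qed (use fin assms(2) in \<open>auto intro!: integrable_pmf_unit integrable_mult_right weight_nonneg weight_le_1\<close>)
    finally show ?thesis
      using u by (simp add: weight_step[OF less.prems, of u])
  qed
qed

lemma weight_Un_finite_ge:
  fixes Q :: "(int ^ 'd) set pmf"
  assumes "finite (- E)" "0 \<le> h" "0 \<le> a" "finite B"
    and "\<And>x F. finite (- F) \<Longrightarrow> a \<le> weight Q h {x} F"
  shows "a ^ card B * weight Q h R E \<le> weight Q h (R \<union> B) E"
  using assms(4)
proof (induction B rule: finite_induct)
  case (insert x B)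
  have "a ^ card (insert x B) * weight Q h R E = a * (a ^ card B * weight Q h R E)"
    using insert.hyps by simp
  also have "\<dots> \<le> a * weight Q h (R \<union> B) E"
    using insert.IH assms(3) by (rule mult_left_mono)
  also have "\<dots> \<le> weight Q h (R \<union> B \<union> {x}) E"
    using assms by (intro weight_Un_ge)
  finally show ?case by (simp add: Un_ac)
qed simp

section \<open>Comparison of \<open>P\<close>-hitting with weighted \<open>Q\<close>-hitting\<close>

text \<open>The function \<open>S \<mapsto> hit P T (R \<union> (u + S)) E\<close> is a nonnegative combination of a constant and of
  the functions \<open>S \<mapsto> [S \<inter> A \<noteq> {}]\<close>; the sets \<open>A\<close> that occur are proper because \<open>R\<close> contains a
  neighbour of \<open>u\<close>, and a neighbour in \<open>A \<inter> R\<close> would already make the constant term equal to 1.\<close>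
lemma hit_decomposition:
  fixes P :: "(int ^ 'd) set pmf" and u :: "int ^ 'd"
  assumes fin: "finite (- E)" and R: "R \<inter> (+) u ` nbrs 0 \<noteq> {}" and nbrs: "finite (nbrs (0 :: int ^ 'd))"
  obtains c :: real and p :: "(int ^ 'd) set \<Rightarrow> real"
  where "0 \<le> c" "\<And>A. 0 \<le> p A" "p (nbrs 0) = 0"
    "\<And>S. S \<subseteq> nbrs 0 \<Longrightarrow>
      hit P T (R \<union> (+) u ` S) E = c + (\<Sum>A\<in>Pow (nbrs 0). p A * of_bool (S \<inter> A \<noteq> {}))"
proof -
  interpret prob_space "config_measure P" by (rule prob_space_config)
  \<comment> \<open>\<open>A \<omega>\<close> collects the directions from which the target would be
    hit. If \<open>R\<close> alone misses, adding \<open>u + S\<close> produces a hit exactly when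
    \<open>S\<close> meets \<open>A \<omega>\<close>, so \<open>p\<close> is the law of this set on
    the event of a miss.\<close>
  define A where "A \<omega> = {x \<in> nbrs 0. cluster E {u + x} \<omega> \<inter> T \<noteq> {}}" for \<omega>
  define miss where "miss \<omega> \<longleftrightarrow> cluster E R \<omega> \<inter> T = {}" for \<omega>
  define p :: "(int ^ 'd) set \<Rightarrow> real" where "p B = (\<integral>\<omega>. of_bool (miss \<omega> \<and> A \<omega> = B) \<partial>config_measure P)" for B
  have [measurable]: "Measurable.pred (config_measure P) (\<lambda>\<omega>. miss \<omega> \<and> A \<omega> = B)" for B
  proof -
    have "(miss \<omega> \<and> A \<omega> = B) \<longleftrightarrow> (\<forall>v. v \<in> cluster E R \<omega> \<longrightarrow> v \<notin> T) \<and>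
       (\<forall>x. x \<in> B \<longleftrightarrow> x \<in> nbrs 0 \<and> (\<exists>v. v \<in> cluster E {u + x} \<omega> \<and> v \<in> T))" for \<omega>
      by (auto simp: miss_def A_def)
    then show ?thesis by simp
  qed
  have int: "integrable (config_measure P) (\<lambda>\<omega>. of_bool (miss \<omega> \<and> A \<omega> = B) :: real)" for B
    by (rule integrable_const_bound[where B = 1]) auto
  have proper: "\<not> (miss \<omega> \<and> A \<omega> = nbrs 0)" for \<omega>
  proof
    assume *: "miss \<omega> \<and> A \<omega> = nbrs 0"
    obtain x where "x \<in> nbrs 0" "u + x \<in> R" using R by auto
    then have "cluster E {u + x} \<omega> \<inter> T \<noteq> {}" "cluster E {u + x} \<omega> \<subseteq> cluster E R \<omega>"
      using * cluster_mono[of "{u + x}" R E E] by (auto simp: A_def)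
    then show False using * by (auto simp: miss_def)
  qed
  have cl: "cluster E ((+) u ` S) \<omega> = (\<Union>x\<in>S. cluster E {u + x} \<omega>)" for S \<omega>
    by (auto simp: cluster_def)
  show thesis
  proof (rule that[of "hit P T R E" p])
    have "of_bool (miss \<omega> \<and> A \<omega> = nbrs 0) = (0 :: real)" for \<omega>
      using proper[of \<omega>] by simp
    then show "p (nbrs 0) = 0" unfolding p_def by (simp only: integral_zero)
    fix S :: "(int ^ 'd) set" assume S: "S \<subseteq> nbrs 0"
    have "of_bool (cluster E (R \<union> (+) u ` S) \<omega> \<inter> T \<noteq> {}) = of_bool (cluster E R \<omega> \<inter> T \<noteq> {}) +
        (\<Sum>B\<in>Pow (nbrs 0). of_bool (miss \<omega> \<and> A \<omega> = B) * (of_bool (S \<inter> B \<noteq> {}) :: real))" for \<omega>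
    proof -
      have "(\<Sum>B\<in>Pow (nbrs 0). of_bool (miss \<omega> \<and> A \<omega> = B) * (of_bool (S \<inter> B \<noteq> {}) :: real))
          = (\<Sum>B\<in>Pow (nbrs 0). if A \<omega> = B then of_bool (miss \<omega> \<and> S \<inter> A \<omega> \<noteq> {}) else 0)"
        by (intro sum.cong) auto
      also have "\<dots> = of_bool (miss \<omega> \<and> S \<inter> A \<omega> \<noteq> {})"
        using nbrs by (subst sum.delta') (auto simp: A_def)
      moreover have "S \<inter> A \<omega> \<noteq> {} \<longleftrightarrow> cluster E ((+) u ` S) \<omega> \<inter> T \<noteq> {}"
        using S unfolding cl by (auto simp: A_def)
      ultimately show ?thesis by (auto simp: cluster_Un miss_def)
    qed
    then show "hit P T (R \<union> (+) u ` S) E = hit P T R E + (\<Sum>A\<in>Pow (nbrs 0). p A * of_bool (S \<inter> A \<noteq> {}))"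
      unfolding hit_def p_def using int
      by (simp add: integrable_cluster[OF fin, where f = "\<lambda>C. of_bool (C \<inter> T \<noteq> {})"])
  qed (auto simp: p_def hit_bounds)
qed

text \<open>By \<open>hit_decomposition\<close> both sides are linear in the same nonnegative
  coefficients, so it suffices to compare them for the constant 1, where equality holds, and for
  each event that \<open>S\<close> meets a proper subset \<open>A\<close>.\<close>

lemma correlation_step:
  fixes P Q :: "(int ^ 'd) set pmf" and u :: "int ^ 'd"
  assumes nbrs: "finite (nbrs (0 :: int ^ 'd))"
    and P: "set_pmf P \<subseteq> Pow (nbrs 0)" and Q: "set_pmf Q \<subseteq> Pow (nbrs 0)" and "0 \<le> h" "0 \<le> b"
    and PQ: "\<And>A. A \<subset> nbrs 0 \<Longrightarrow>
      measure_pmf.prob P {S. S \<inter> A \<noteq> {}} \<le> b * measure_pmf.prob Q {S. S \<inter> A \<noteq> {}}"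
    and b: "\<And>S. S \<subseteq> nbrs 0 \<Longrightarrow> b * weight Q h R E \<le> weight Q h (R \<union> (+) u ` S) E"
    and fin: "finite (- E)" and R: "R \<inter> (+) u ` nbrs 0 \<noteq> {}"
  shows "(\<integral>S. hit P T (R \<union> (+) u ` S) E \<partial>P) * (\<integral>S. weight Q h (R \<union> (+) u ` S) E \<partial>Q)
    \<le> (\<integral>S. hit P T (R \<union> (+) u ` S) E * weight Q h (R \<union> (+) u ` S) E \<partial>Q)"
proof -
  obtain c p where c: "0 \<le> c" and p: "\<And>A. 0 \<le> p A" "p (nbrs 0) = (0 :: real)"
    and dec: "\<And>S. S \<subseteq> nbrs 0 \<Longrightarrow>
      hit P T (R \<union> (+) u ` S) E = c + (\<Sum>A\<in>Pow (nbrs 0). p A * of_bool (S \<inter> A \<noteq> {}))"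
    using hit_decomposition[OF fin R nbrs] by blast
  define Z where "Z S = weight Q h (R \<union> (+) u ` S) E" for S
  have Z: "0 \<le> Z S" "Z S \<le> 1" "Z S \<le> weight Q h R E" for S
    using assms by (auto simp: Z_def intro!: weight_nonneg weight_le_1 weight_antimono)
  have intZ: "integrable (measure_pmf Q) Z"
    using Z by (intro integrable_pmf_unit)
  have intbZ: "integrable (measure_pmf Q) (\<lambda>S. of_bool (S \<inter> A \<noteq> {}) * Z S)" for A
    using Z by (intro integrable_pmf_unit) auto
  have intb: "integrable (measure_pmf p) (\<lambda>S. of_bool (S \<inter> A \<noteq> {}) :: real)" for A :: "(int ^ 'd) set" and p :: "(int ^ 'd) set pmf"
    by (intro integrable_pmf_unit) auto
  have prob: "(\<integral>S. of_bool (S \<inter> A \<noteq> {}) \<partial>p) = measure_pmf.prob p {S. S \<inter> A \<noteq> {}}"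
    for A :: "(int ^ 'd) set" and p :: "(int ^ 'd) set pmf"
  proof -
    have "(\<integral>S. of_bool (S \<inter> A \<noteq> {}) \<partial>p) = (\<integral>S. indicator {S. S \<inter> A \<noteq> {}} S \<partial>measure_pmf p :: real)"
      by (intro Bochner_Integration.integral_cong) (auto simp: indicator_def)
    then show ?thesis by simp
  qed
  have hitP: "(\<integral>S. hit P T (R \<union> (+) u ` S) E \<partial>P) =
      c + (\<Sum>A\<in>Pow (nbrs 0). p A * measure_pmf.prob P {S. S \<inter> A \<noteq> {}})"
  proof -
    have "(\<integral>S. hit P T (R \<union> (+) u ` S) E \<partial>P) =
       (\<integral>S. c + (\<Sum>A\<in>Pow (nbrs 0). p A * of_bool (S \<inter> A \<noteq> {})) \<partial>P)"
      using P by (intro integral_cong_AE) (auto simp: AE_measure_pmf_iff intro!: dec)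
    also have "\<dots> = c + (\<Sum>A\<in>Pow (nbrs 0). p A * measure_pmf.prob P {S. S \<inter> A \<noteq> {}})"
      using intb by (simp add: prob)
    finally show ?thesis .
  qed
  have hitQ: "(\<integral>S. hit P T (R \<union> (+) u ` S) E * Z S \<partial>Q) =
      c * (\<integral>S. Z S \<partial>Q) + (\<Sum>A\<in>Pow (nbrs 0). p A * (\<integral>S. of_bool (S \<inter> A \<noteq> {}) * Z S \<partial>Q))"
  proof -
    have "(\<integral>S. hit P T (R \<union> (+) u ` S) E * Z S \<partial>Q) =
       (\<integral>S. c * Z S + (\<Sum>A\<in>Pow (nbrs 0). p A * (of_bool (S \<inter> A \<noteq> {}) * Z S)) \<partial>Q)"
    proof (intro integral_cong_AE AE_pmfI)
      fix S assume "S \<in> set_pmf Q"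
      then have "S \<subseteq> nbrs 0" using Q by auto
      then show "hit P T (R \<union> (+) u ` S) E * Z S =
          c * Z S + (\<Sum>A\<in>Pow (nbrs 0). p A * (of_bool (S \<inter> A \<noteq> {}) * Z S))"
        by (simp add: dec distrib_right sum_distrib_right mult.assoc)
    qed auto
    also have "\<dots> = c * (\<integral>S. Z S \<partial>Q) + (\<Sum>A\<in>Pow (nbrs 0). p A * (\<integral>S. of_bool (S \<inter> A \<noteq> {}) * Z S \<partial>Q))"
      using intZ intbZ by simp
    finally show ?thesis .
  qed
  \<comment> \<open>The weight \<open>Z S\<close> lies between \<open>b * weight Q h R E\<close> and
    \<open>weight Q h R E\<close>. The factor \<open>b\<close> lost in this variation is exactly
    what the gap between \<open>P\<close> and \<open>Q\<close> provides.\<close>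
  have key: "measure_pmf.prob P {S. S \<inter> A \<noteq> {}} * (\<integral>S. Z S \<partial>Q) \<le> (\<integral>S. of_bool (S \<inter> A \<noteq> {}) * Z S \<partial>Q)"
    if A: "A \<subset> nbrs 0" for A
  proof -
    have "measure_pmf.prob P {S. S \<inter> A \<noteq> {}} * (\<integral>S. Z S \<partial>Q)
        \<le> measure_pmf.prob P {S. S \<inter> A \<noteq> {}} * weight Q h R E"
      using Z intZ by (intro mult_left_mono measure_pmf.integral_le_const) auto
    also have "\<dots> \<le> b * measure_pmf.prob Q {S. S \<inter> A \<noteq> {}} * weight Q h R E"
      using PQ[OF A] weight_nonneg by (rule mult_right_mono)
    also have "\<dots> = (\<integral>S. of_bool (S \<inter> A \<noteq> {}) * (b * weight Q h R E) \<partial>Q)"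
      by (simp add: prob)
    also have "\<dots> \<le> (\<integral>S. of_bool (S \<inter> A \<noteq> {}) * Z S \<partial>Q)"
      using Q b intb intbZ
      by (intro integral_mono_AE) (auto simp: AE_measure_pmf_iff Z_def intro!: mult_left_mono)
    finally show ?thesis .
  qed
  \<comment> \<open>For the full neighbourhood no comparison of \<open>P\<close> and
    \<open>Q\<close> is available, but its coefficient vanishes.\<close>
  have "p A * measure_pmf.prob P {S. S \<inter> A \<noteq> {}} * (\<integral>S. Z S \<partial>Q) \<le> p A * (\<integral>S. of_bool (S \<inter> A \<noteq> {}) * Z S \<partial>Q)"
    if "A \<subseteq> nbrs 0" for A
    using p key[of A] that by (cases "A = nbrs 0") (auto simp: mult.assoc intro!: mult_left_mono)
  then show ?thesis
    unfolding Z_def[symmetric] hitP hitQ distrib_right sum_distrib_right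
    by (intro add_left_mono sum_mono) auto
qed

text \<open>The comparison of hitting probabilities, multiplied out by the normalising constant.
  Exploring one unexplored root at a time, \<open>correlation_step\<close> turns the product of a
  \<open>P\<close>-mean and a \<open>Q\<close>-mean into one \<open>Q\<close>-mean, to which
  induction applies. The condition on \<open>R\<close> keeps every set that has to be compared a
  proper subset of the neighbourhood.\<close>

lemma hit_mult_weight_le:
  fixes P Q :: "(int ^ 'd) set pmf"
  assumes nbrs: "finite (nbrs (0 :: int ^ 'd))"
    and P: "set_pmf P \<subseteq> Pow (nbrs 0)" and Q: "set_pmf Q \<subseteq> Pow (nbrs 0)" and "0 \<le> h" "0 \<le> b"
    and PQ: "\<And>A. A \<subset> nbrs 0 \<Longrightarrow>
      measure_pmf.prob P {S. S \<inter> A \<noteq> {}} \<le> b * measure_pmf.prob Q {S. S \<inter> A \<noteq> {}}"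
    and b: "\<And>R E u S. finite (- E) \<Longrightarrow> S \<subseteq> nbrs 0 \<Longrightarrow> b * weight Q h R E \<le> weight Q h (R \<union> (+) u ` S) E"
    and fin: "finite (- E)" and R: "\<And>u. u \<in> R - E \<Longrightarrow> R \<inter> (+) u ` nbrs 0 \<noteq> {}"
  shows "hit P T R E * weight Q h R E \<le> hit_weight Q h T R E"
  using fin R
proof (induction "card (- E)" arbitrary: E R rule: less_induct)
  case less
  note fin = less.prems(1)
  show ?case
  proof (cases "R \<subseteq> E")
    case True
    then show ?thesis by (simp add: hit_def hit_weight_def cluster_empty)
  next
    case False
    then obtain u where u: "u \<in> R" "u \<notin> E" by blast
    have fin': "finite (- insert u E)" using fin by (rule rev_finite_subset) auto
    have card: "card (- insert u E) < card (- E)"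
      using fin u by (intro psubset_card_mono) auto
    show ?thesis
    proof (cases "u \<in> T")
      case True
      then have "cluster E R \<omega> \<inter> T \<noteq> {}" for \<omega>
        using u by (auto intro: cluster_base)
      then have "hit_weight Q h T R E = weight Q h R E"
        by (simp add: hit_weight_def weight_def)
      then show ?thesis
        using hit_bounds(2)[OF fin, of P T R] weight_nonneg[of Q h R E] by (simp add: mult_left_le_one_le hit_bounds(1))
    next
      case False
      let ?V = "\<lambda>S. hit P T (R \<union> (+) u ` S) (insert u E)"
      let ?Z = "\<lambda>S. weight Q h (R \<union> (+) u ` S) (insert u E)"
      let ?W = "\<lambda>S. hit_weight Q h T (R \<union> (+) u ` S) (insert u E)"
      have hit: "hit P T R E = (\<integral>S. ?V S \<partial>P)"
        using False
        by (simp add: hit_def integral_cluster_step[OF fin u, where f = "\<lambda>C. of_bool (C \<inter> T \<noteq> {})"])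
      have "finite (cluster (insert u E) X \<omega>)" for X \<omega>
        using fin' by (rule finite_subset[OF cluster_subset])
      then have "card (insert u (cluster (insert u E) X \<omega>)) = Suc (card (cluster (insert u E) X \<omega>))" for X \<omega>
        using cluster_disjoint[of u "insert u E"] by (subst card_insert_disjoint) auto
      then have hw: "hit_weight Q h T R E = exp (- h) * (\<integral>S. ?W S \<partial>Q)"
        using False unfolding hit_weight_def
        by (subst integral_cluster_step[OF fin u, where f = "\<lambda>C. of_bool (C \<inter> T \<noteq> {}) * exp (- h * real (card C))"])
          (simp add: exp_diff exp_minus divide_inverse distrib_left mult.commute mult.left_commute)
      have W: "0 \<le> ?W S" "?W S \<le> 1" for S
      proof -
        interpret prob_space "config_measure Q" by (rule prob_space_config)
        show "0 \<le> ?W S" by (simp add: hit_weight_def)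
        show "?W S \<le> 1" unfolding hit_weight_def using \<open>0 \<le> h\<close>
          by (intro integral_le_const AE_I2
              integrable_cluster[OF fin', where f = "\<lambda>C. of_bool (C \<inter> T \<noteq> {}) * exp (- h * real (card C))"]) auto
      qed
      have "hit P T R E * weight Q h R E = exp (- h) * ((\<integral>S. ?V S \<partial>P) * (\<integral>S. ?Z S \<partial>Q))"
        by (simp add: hit weight_step[OF fin u])
      also have "\<dots> \<le> exp (- h) * (\<integral>S. ?V S * ?Z S \<partial>Q)"
        using less.prems(2)[of u] u
        by (intro mult_left_mono correlation_step[where b = b] assms b fin') auto
      also have "\<dots> \<le> exp (- h) * (\<integral>S. ?W S \<partial>Q)"
      proof (intro mult_left_mono integral_mono_AE AE_pmfI)
        fix S assume "S \<in> set_pmf Q"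
        then have S: "S \<subseteq> nbrs 0" using Q by auto
        show "?V S * ?Z S \<le> ?W S"
        proof (rule less.hyps[OF card fin'])
          \<comment> \<open>The neighbour condition survives the step: an old root keeps its
            neighbour, and a new root \<open>u + s\<close> has the neighbour \<open>u\<close>, which
            remains in \<open>R\<close>.\<close>
          fix v assume v: "v \<in> R \<union> (+) u ` S - insert u E"
          show "(R \<union> (+) u ` S) \<inter> (+) v ` nbrs 0 \<noteq> {}"
          proof (cases "v \<in> R")
            case True
            then show ?thesis using less.prems(2)[of v] v by blast
          next
            case False
            then obtain s where s: "s \<in> S" "v = u + s" using v by auto
            then have "- s \<in> nbrs 0" using S by (auto simp: nbrs_def norm1_def)
            moreover have "u = v + - s" using s by simp
            ultimately show ?thesis using u by blast
          qed
        qed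
      next
        show "integrable (measure_pmf Q) (\<lambda>S. ?V S * ?Z S)"
          using fin' \<open>0 \<le> h\<close>
          by (intro integrable_pmf_unit mult_nonneg_nonneg mult_le_one hit_bounds weight_nonneg weight_le_1)
        show "integrable (measure_pmf Q) ?W"
          using W by (intro integrable_pmf_unit)
      qed auto
      finally show ?thesis by (simp add: hw)
    qed
  qed
qed


subsection \<open>Bounds on the weights\<close>

lemma norm1_triangle: "norm1 (x + y) \<le> norm1 x + norm1 y"
  by (simp add: norm1_def sum.distrib[symmetric] sum_mono)

lemma norm1_minus: "norm1 (- x) = norm1 x"
  by (simp add: norm1_def)

lemma norm1_nbrs_le: "v \<in> nbrs u \<Longrightarrow> norm1 v \<le> norm1 u + 1"
  using norm1_triangle[of u "v - u"] norm1_minus[of "v - u"] by (simp add: nbrs_def)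

lemma finite_ball1: "finite (ball1 n :: (int ^ 'd) set)"
proof (rule finite_subset)
  show "(ball1 n :: (int ^ 'd) set) \<subseteq> vec_lambda ` (UNIV \<rightarrow>\<^sub>E {- int n..int n})"
  proof
    fix x :: "int ^ 'd" assume x: "x \<in> ball1 n"
    have "\<bar>x $ i\<bar> \<le> norm1 x" for i
      unfolding norm1_def by (rule member_le_sum) auto
    then have "\<bar>x $ i\<bar> \<le> int n" for i
      using x order_trans by (fastforce simp: ball1_def)
    then have "(\<lambda>i. x $ i) \<in> UNIV \<rightarrow>\<^sub>E {- int n..int n}"
      by (auto simp: abs_le_iff minus_le_iff)
    then show "x \<in> vec_lambda ` (UNIV \<rightarrow>\<^sub>E {- int n..int n})"
      by (rule rev_image_eqI) simp
  qed
qed (simp add: finite_PiE)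

lemma finite_nbrs_0: "finite (nbrs 0 :: (int ^ 'd) set)"
  by (rule finite_subset[OF _ finite_ball1[of 1]]) (auto simp: nbrs_def ball1_def norm1_minus)

text \<open>Translation invariance, checked on finite cylinders, which determine a product
  measure.\<close>

lemma distr_config_shift:
  fixes Q :: "(int ^ 'd) set pmf" and b :: "int ^ 'd"
  shows "distr (config_measure Q) (config_measure Q) (\<lambda>\<omega> u. (\<lambda>x. x - b) ` \<omega> (b + u)) = config_measure Q"
    and "(\<lambda>\<omega> u. (\<lambda>x. x - b) ` \<omega> (b + u)) \<in> measurable (config_measure Q) (config_measure Q)"
proof -
  let ?shift = "\<lambda>(\<omega> :: int ^ 'd \<Rightarrow> (int ^ 'd) set) u. (\<lambda>x. x - b) ` \<omega> (b + u)"
  interpret product_prob_space "local_law Q" UNIV ..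
  show meas: "?shift \<in> measurable (config_measure Q) (config_measure Q)"
  proof (subst (2) config_measure_def, rule measurable_PiM_single')
    fix u :: "int ^ 'd"
    have "(\<lambda>\<omega>. \<omega> (b + u)) \<in> measurable (config_measure Q) (count_space UNIV)"
      unfolding measurable_cong_sets[OF sets_config refl] by simp
    then show "(\<lambda>\<omega>. ?shift \<omega> u) \<in> measurable (config_measure Q) (local_law Q u)"
      by (rule measurable_compose) simp
  qed auto
  show "distr (config_measure Q) (config_measure Q) ?shift = config_measure Q"
  proof (subst (3) config_measure_def, rule PiM_eq)
    fix J :: "(int ^ 'd) set" and F
    assume J: "finite J" and F: "\<And>j. j \<in> J \<Longrightarrow> F j \<in> sets (local_law Q j)"
    \<comment> \<open>Coordinate \<open>j\<close> of the shifted configuration comes from coordinate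
      \<open>b + j\<close> of the original one; \<open>G\<close> is the corresponding pulled-back
      condition.\<close>
    define G where "G v = {T. (\<lambda>x. x - b) ` T \<in> F (v - b)}" for v
    have emb: "prod_emb UNIV (local_law Q) J (\<Pi>\<^sub>E j\<in>J. F j) = {\<omega>. \<forall>j\<in>J. \<omega> j \<in> F j}"
      by (auto simp: prod_emb_def)
    have "{\<omega>. \<forall>j\<in>J. \<omega> j \<in> F j} \<in> sets (config_measure Q)"
      unfolding emb[symmetric] config_measure_def using J F by (intro sets_PiM_I) auto
    then have "emeasure (distr (config_measure Q) (config_measure Q) ?shift) {\<omega>. \<forall>j\<in>J. \<omega> j \<in> F j}
        = emeasure (config_measure Q) (?shift -` {\<omega>. \<forall>j\<in>J. \<omega> j \<in> F j})"
      using meas by (simp add: emeasure_distr)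
    also have "?shift -` {\<omega>. \<forall>j\<in>J. \<omega> j \<in> F j} =
        {\<omega> \<in> space (PiM UNIV (local_law Q)). \<forall>v\<in>(+) b ` J. \<omega> v \<in> G v}"
      by (auto simp: G_def space_PiM)
    also have "emeasure (config_measure Q) \<dots> = (\<Prod>v\<in>(+) b ` J. emeasure (local_law Q v) (G v))"
      unfolding config_measure_def using J by (intro emeasure_PiM_Collect) auto
    also have "\<dots> = (\<Prod>j\<in>J. emeasure (local_law Q (b + j)) (G (b + j)))"
      by (subst prod.reindex) (auto simp: inj_on_def)
    also have "\<dots> = (\<Prod>j\<in>J. emeasure (local_law Q j) (F j))"
    proof (rule prod.cong)
      fix j
      have "(\<lambda>x. x - b) ` (+) (b + j) ` S = (+) j ` S" for S
        by (auto simp: image_image algebra_simps)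
      then show "emeasure (local_law Q (b + j)) (G (b + j)) = emeasure (local_law Q j) (F j)"
        by (simp add: G_def emeasure_map_pmf vimage_def)
    qed simp
    finally show "emeasure (distr (config_measure Q) (config_measure Q) ?shift)
        (prod_emb UNIV (local_law Q) J (\<Pi>\<^sub>E j\<in>J. F j)) = (\<Prod>j\<in>J. emeasure (local_law Q j) (F j))"
      unfolding emb .
  qed (simp add: config_measure_def)
qed

lemma sets_cluster_subset: "{\<omega>. cluster E R \<omega> \<subseteq> A} \<in> sets (config_measure Q)"
proof -
  have "Measurable.pred (config_measure Q) (\<lambda>\<omega>. \<forall>v. v \<in> cluster E R \<omega> \<longrightarrow> v \<in> A)"
    by measurable
  then show ?thesis by (simp add: pred_def subset_iff)
qed

lemma measure_cluster_translate:
  fixes b :: "int ^ 'd"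
  shows "measure (config_measure Q) {\<omega>. cluster {} {b} \<omega> \<subseteq> (+) b ` A} =
   measure (config_measure Q) {\<omega>. cluster {} {0} \<omega> \<subseteq> A}"
proof -
  let ?shift = "\<lambda>(\<omega> :: int ^ 'd \<Rightarrow> (int ^ 'd) set) u. (\<lambda>x. x - b) ` \<omega> (b + u)"
  have "measure (config_measure Q) {\<omega>. cluster {} {0} \<omega> \<subseteq> A} =
      measure (distr (config_measure Q) (config_measure Q) ?shift) {\<omega>. cluster {} {0} \<omega> \<subseteq> A}"
    by (simp add: distr_config_shift)
  also have "\<dots> = measure (config_measure Q) (?shift -` {\<omega>. cluster {} {0} \<omega> \<subseteq> A})"
    using distr_config_shift(2) sets_cluster_subset by (subst measure_distr) auto
  also have "?shift -` {\<omega>. cluster {} {0} \<omega> \<subseteq> A} = {\<omega>. cluster {} {b} \<omega> \<subseteq> (+) b ` A}"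
    unfolding cluster_translate[of b] by auto
  finally show ?thesis by simp
qed

lemma tendsto_measure_cluster_ball:
  fixes Q :: "(int ^ 'd) set pmf"
  assumes "measure (config_measure Q) percolates = 0"
  shows "(\<lambda>k. measure (config_measure Q) {\<omega>. cluster {} {0} \<omega> \<subseteq> ball1 k}) \<longlonglongrightarrow> 1"
proof -
  interpret prob_space "config_measure Q" by (rule prob_space_config)
  let ?A = "\<lambda>k. {\<omega>. cluster {} {0 :: int ^ 'd} \<omega> \<subseteq> ball1 k}"
  have "(\<Union>k. ?A k) = - percolates"
  proof (intro equalityI subsetI)
    fix \<omega> :: "int ^ 'd \<Rightarrow> (int ^ 'd) set" assume "\<omega> \<in> - percolates"
    then have fin: "finite (cluster {} {0} \<omega>)"
      by (simp add: percolates_def reachable_eq_cluster)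
    have "norm1 x \<le> int (nat (Max (norm1 ` cluster {} {0} \<omega>)))" if "x \<in> cluster {} {0} \<omega>" for x
      using Max_ge[OF finite_imageI[OF fin, of norm1] imageI[OF that]] by linarith
    then have "cluster {} {0} \<omega> \<subseteq> ball1 (nat (Max (norm1 ` cluster {} {0} \<omega>)))"
      unfolding ball1_def by blast
    then show "\<omega> \<in> (\<Union>k. ?A k)" by blast
  qed (auto simp: percolates_def reachable_eq_cluster intro: finite_subset[OF _ finite_ball1])
  moreover have "(\<Union>k. ?A k) \<in> events"
    using sets_cluster_subset by (intro sets.countable_UN) auto
  ultimately have sets: "- percolates \<in> events" and eq: "(\<Union>k. ?A k) = - percolates" by auto
  \<comment> \<open>Since \<open>measure\<close> is 0 on nonmeasurable sets, measurability must be
    known before the hypothesis yields probability 1 for the complement.\<close>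
  have "percolates \<in> events"
    using sets.compl_sets[OF sets] by (simp add: Compl_eq_Diff_UNIV[symmetric])
  then have "prob (\<Union>k. ?A k) = 1"
    using prob_compl[of percolates] assms by (simp add: eq Compl_eq_Diff_UNIV)
  moreover have "(\<lambda>k. prob (?A k)) \<longlonglongrightarrow> prob (\<Union>k. ?A k)"
    using sets_cluster_subset
    by (intro finite_Lim_measure_incseq) (fastforce simp: incseq_def ball1_def)+
  ultimately show ?thesis by simp
qed

text \<open>Keep only the event that the unrestricted cluster of \<open>b\<close> fits into the ball
  around \<open>b\<close>; avoiding \<open>F\<close> makes the cluster smaller still. Translation
  invariance makes the bound uniform in \<open>b\<close> and \<open>F\<close>.\<close>

lemma weight_singleton_ge:
  fixes Q :: "(int ^ 'd) set pmf"
  assumes "finite (- F)" "0 \<le> h"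
  shows "exp (- h * real (card (ball1 k :: (int ^ 'd) set))) *
    measure (config_measure Q) {\<omega>. cluster {} {0} \<omega> \<subseteq> ball1 k} \<le> weight Q h {b} F"
proof -
  interpret prob_space "config_measure Q" by (rule prob_space_config)
  let ?A = "{\<omega>. cluster {} {b} \<omega> \<subseteq> (+) b ` ball1 k}"
  let ?c = "exp (- h * real (card (ball1 k :: (int ^ 'd) set)))"
  have "?c * measure (config_measure Q) {\<omega>. cluster {} {0} \<omega> \<subseteq> ball1 k} =
      (\<integral>\<omega>. ?c * indicator ?A \<omega> \<partial>config_measure Q)"
    by (simp add: measure_cluster_translate)
  also have "\<dots> \<le> weight Q h {b} F"
    unfolding weight_def
  proof (rule integral_mono)
    show "integrable (config_measure Q) (\<lambda>\<omega>. ?c * indicator ?A \<omega>)"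
      using sets_cluster_subset
      by (intro integrable_mult_right integrable_real_indicator) (auto simp: emeasure_eq_measure)
    show "integrable (config_measure Q) (\<lambda>\<omega>. exp (- h * real (card (cluster F {b} \<omega>))))"
      by (rule integrable_cluster[OF assms(1), where f = "\<lambda>C. exp (- h * real (card C))"])
    fix \<omega>
    show "?c * indicator ?A \<omega> \<le> exp (- h * real (card (cluster F {b} \<omega>)))"
    proof (cases "\<omega> \<in> ?A")
      case True
      have "card (cluster F {b} \<omega>) \<le> card ((+) b ` ball1 k)"
        using True cluster_mono[of "{b}" "{b}" "{}" F \<omega>]
        by (intro card_mono finite_imageI finite_ball1) auto
      also have "\<dots> = card (ball1 k :: (int ^ 'd) set)"
        by (rule card_image) (auto simp: inj_on_def)
      finally show ?thesis using assms(2) True by (simp add: mult_left_mono)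
    qed simp
  qed
  finally show ?thesis .
qed

text \<open>First a radius is chosen that contains the cluster with probability above
  \<open>1 - e / 2\<close>, then \<open>h\<close> so small that the exponential factor for the whole
  ball is at least \<open>1 - e / 2\<close>.\<close>

lemma ex_weight_ge:
  fixes Q :: "(int ^ 'd) set pmf"
  assumes "measure (config_measure Q) percolates = 0" "0 < e"
  obtains h where "0 < h" "\<And>b F. finite (- F) \<Longrightarrow> 1 - e \<le> weight Q h {b} F"
proof -
  let ?p = "\<lambda>k. measure (config_measure Q) {\<omega>. cluster {} {0} \<omega> \<subseteq> ball1 k}"
  have "eventually (\<lambda>k. 1 - e / 2 < ?p k) sequentially"
    using tendsto_measure_cluster_ball[OF assms(1)] assms(2) by (intro order_tendstoD(1)) auto
  then obtain k where k: "1 - e / 2 < ?p k"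
    by (auto simp: eventually_sequentially)
  interpret prob_space "config_measure Q" by (rule prob_space_config)
  define N where "N = real (card (ball1 k :: (int ^ 'd) set))"
  define h where "h = e / (2 * (N + 1))"
  have N: "0 \<le> N" by (simp add: N_def)
  have "0 < h" using assms(2) N by (simp add: h_def)
  have "h * N \<le> e / 2"
    using assms(2) N by (simp add: h_def field_simps)
  then have "1 - e / 2 \<le> exp (- h * N)"
    using exp_ge_add_one_self[of "- h * N"] by linarith
  have "1 - e \<le> exp (- h * N) * ?p k"
  proof -
    \<comment> \<open>Expanded, this says that the product of two numbers in [0, 1] is at least
      their sum minus 1.\<close>
    have "(1 - exp (- h * N)) * (1 - ?p k) \<ge> 0"
      using \<open>0 < h\<close> N by (intro mult_nonneg_nonneg) auto
    then show ?thesis using k \<open>1 - e / 2 \<le> exp (- h * N)\<close> by (simp add: algebra_simps)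
  qed
  then show thesis
    using weight_singleton_ge[of _ h k Q] \<open>0 < h\<close>
    by (intro that[of h]) (auto simp: N_def intro: order_trans)
qed

section \<open>Choice of the constants\<close>

lemma uniform_strict_ratio:
  fixes P Q :: "(int ^ 'd) set pmf"
  assumes "\<And>A. {} \<subset> A \<Longrightarrow> A \<subset> nbrs 0 \<Longrightarrow>
    measure_pmf.prob P {S. S \<inter> A \<noteq> {}} < measure_pmf.prob Q {S. S \<inter> A \<noteq> {}}"
  obtains b where "0 \<le> b" "b < 1" "\<And>A. A \<subset> nbrs 0 \<Longrightarrow>
    measure_pmf.prob P {S. S \<inter> A \<noteq> {}} \<le> b * measure_pmf.prob Q {S. S \<inter> A \<noteq> {}}"
proof -
  let ?p = "\<lambda>A. measure_pmf.prob P {S. S \<inter> A \<noteq> {}}" and ?q = "\<lambda>A. measure_pmf.prob Q {S. S \<inter> A \<noteq> {}}"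
  define X where "X = {A. {} \<subset> A \<and> A \<subset> (nbrs 0 :: (int ^ 'd) set)}"
  have X: "finite X"
    using finite_nbrs_0 by (rule_tac finite_subset[of _ "Pow (nbrs 0)"]) (auto simp: X_def)
  \<comment> \<open>Finitely many strict inequalities leave a uniform gap. Inserting 0 keeps the
    maximum well defined and nonnegative.\<close>
  define b where "b = Max (insert 0 ((\<lambda>A. ?p A / ?q A) ` X))"
  have pq: "?p A < ?q A" if "A \<in> X" for A using that assms by (auto simp: X_def)
  have pos: "0 < ?q A" if "A \<in> X" for A using pq[OF that] measure_nonneg[of P] by (rule_tac le_less_trans)
  show thesis
  proof (rule that)
    show "0 \<le> b" using X by (simp add: b_def)
    show "b < 1" using X pq pos by (auto simp: b_def)
    fix A :: "(int ^ 'd) set" assume A: "A \<subset> nbrs 0"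
    show "?p A \<le> b * ?q A"
    proof (cases "A = {}")
      case False
      then have "A \<in> X" using A by (auto simp: X_def)
      then have "?p A / ?q A \<le> b" using X by (auto simp: b_def)
      then show ?thesis using pos[OF \<open>A \<in> X\<close>] by (simp add: field_simps)
    qed simp
  qed
qed

lemma ex_weight_Un_ge:
  fixes Q :: "(int ^ 'd) set pmf"
  assumes "measure (config_measure Q) percolates = 0" "0 \<le> b" "b < 1"
  obtains h where "0 < h" "\<And>x F. finite (- F) \<Longrightarrow> 1 / 2 \<le> weight Q h {x} F"
    "\<And>R E u S. finite (- E) \<Longrightarrow> S \<subseteq> nbrs 0 \<Longrightarrow> b * weight Q h R E \<le> weight Q h (R \<union> (+) u ` S) E"
proof -
  \<comment> \<open>Each added vertex costs a factor \<open>1 - e\<close>, and by Bernoulli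
    \<open>D\<close> of them cost at most \<open>1 - D * e = b\<close>. The summand 2 forces
    \<open>e \<le> 1 / 2\<close>, which gives the bound for single vertices.\<close>
  define D where "D = card (nbrs 0 :: (int ^ 'd) set) + 2"
  define e where "e = (1 - b) / real D"
  have e: "0 < e" "e \<le> 1 / 2" "real D * e = 1 - b"
    using assms by (auto simp: e_def D_def field_simps)
  obtain h where h: "0 < h" and w: "\<And>x F. finite (- F) \<Longrightarrow> 1 - e \<le> weight Q h {x} F"
    using ex_weight_ge[OF assms(1) e(1)] by blast
  show thesis
  proof (rule that[OF h])
    show "1 / 2 \<le> weight Q h {x} F" if "finite (- F)" for x F
      using w[OF that, of x] e by linarith
    fix R E S :: "(int ^ 'd) set" and u :: "int ^ 'd" assume fin: "finite (- E)" and S: "S \<subseteq> nbrs 0"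
    have "finite S" using S finite_nbrs_0 by (rule finite_subset)
    have "card ((+) u ` S) \<le> card S" using \<open>finite S\<close> by (rule card_image_le)
    also have "\<dots> \<le> D" using card_mono[OF finite_nbrs_0 S] by (simp add: D_def)
    finally have card: "card ((+) u ` S) \<le> D" .
    have "b \<le> (1 - e) ^ D"
      using Bernoulli_inequality[of "- e" D] e by simp
    also have "\<dots> \<le> (1 - e) ^ card ((+) u ` S)"
      using card e by (intro power_decreasing) auto
    finally have "b * weight Q h R E \<le> (1 - e) ^ card ((+) u ` S) * weight Q h R E"
      using weight_nonneg by (rule mult_right_mono)
    also have "\<dots> \<le> weight Q h (R \<union> (+) u ` S) E"
      using fin h e w \<open>finite S\<close> by (intro weight_Un_finite_ge) auto
    finally show "b * weight Q h R E \<le> weight Q h (R \<union> (+) u ` S) E" .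
  qed
qed

subsection \<open>Reaching the boundary of a ball\<close>

text \<open>Cut a path to the boundary after its last visit to the origin and at its first arrival
  in \<open>bdry n\<close>: the remaining piece starts at a neighbour of the origin, avoids the
  origin and stays in \<open>ball1 (Suc n)\<close>.\<close>

lemma reaches_bdry_imp_cluster:
  fixes \<omega> :: "int ^ 'd \<Rightarrow> (int ^ 'd) set"
  assumes \<omega>: "\<And>u. \<omega> u \<subseteq> nbrs u" and "\<omega> \<in> reaches_bdry n"
  shows "\<exists>x\<in>nbrs 0. cluster (insert 0 (- ball1 (Suc n))) {x} \<omega> \<inter> bdry n \<noteq> {}"
proof (rule ccontr)
  let ?E = "insert 0 (- ball1 (Suc n) :: (int ^ 'd) set)"
  assume *: "\<not> ?thesis"
  obtain v where v: "v \<in> cluster {} {0} \<omega>" "v \<in> bdry n"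
    using assms(2) by (auto simp: reaches_bdry_def reachable_eq_cluster)
  \<comment> \<open>If no such piece exists, reachability never leaves \<open>ball1 n\<close>: one
    step from there ends in \<open>ball1 (Suc n)\<close>, and \<open>*\<close> excludes the outer
    layer.\<close>
  from v(1) have "v = 0 \<or> v \<in> ball1 n \<and> (\<exists>x\<in>nbrs 0. v \<in> cluster ?E {x} \<omega>)"
  proof (induction rule: cluster_induct)
    case (step v w)
    have "v \<in> ball1 n" using step.IH by (auto simp: ball1_def norm1_def)
    moreover have "w \<in> nbrs v" using step.hyps \<omega> by auto
    ultimately have w: "w \<in> ball1 (Suc n)"
      using norm1_nbrs_le[of w v] by (simp add: ball1_def)
    have "w = 0 \<or> (\<exists>x\<in>nbrs 0. w \<in> cluster ?E {x} \<omega>)"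
    proof (cases "v = 0 \<or> w = 0")
      case True
      then show ?thesis using w \<open>w \<in> nbrs v\<close> by (auto intro!: bexI[of _ w] cluster_base)
    next
      case False
      then obtain x where x: "x \<in> nbrs 0" "v \<in> cluster ?E {x} \<omega>" using step.IH by blast
      have "w \<in> cluster ?E {x} \<omega>"
        using cluster_extend[OF x(2) cluster_disjoint[OF x(2)]] step.hyps w False by auto
      then show ?thesis using x by blast
    qed
    then show ?case using * w by (auto simp: bdry_def)
  qed auto
  then show False using v(2) by (auto simp: bdry_def ball1_def norm1_def)
qed

text \<open>The norm starts at 1 and grows by at most 1 along an edge, so the cluster has a vertex
  of every norm from 1 to \<open>n\<close>.\<close>

lemma card_cluster_ge:
  fixes \<omega> :: "int ^ 'd \<Rightarrow> (int ^ 'd) set"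
  assumes \<omega>: "\<And>u. \<omega> u \<subseteq> nbrs u" and x: "x \<in> nbrs 0"
    and fin: "finite (- E)" and hit: "cluster E {x} \<omega> \<inter> bdry n \<noteq> {}"
  shows "n \<le> card (cluster E {x} \<omega>)"
proof -
  let ?C = "cluster E {x} \<omega>"
  obtain v where v: "v \<in> ?C" "v \<in> bdry n" using hit by blast
  from v(1) have "v \<in> ?C \<and> {1..norm1 v} \<subseteq> norm1 ` ?C"
  proof (induction rule: cluster_induct)
    case (base r)
    then have "r \<in> ?C" "norm1 r = 1"
      using x by (auto simp: nbrs_def norm1_minus intro: cluster_base)
    then show ?case by force
  next
    case (step v w)
    have w: "w \<in> ?C" using step by (blast intro: cluster_extend)
    have "norm1 w \<le> norm1 v + 1" using step.hyps \<omega> by (intro norm1_nbrs_le) auto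
    then have "{1..norm1 w} \<subseteq> insert (norm1 w) {1..norm1 v}" by auto
    then show ?case using step.IH w by blast
  qed
  moreover have "int n \<le> norm1 v" using v(2) by (auto simp: bdry_def ball1_def)
  ultimately have "{1..int n} \<subseteq> norm1 ` ?C" by auto
  then have "card {1..int n} \<le> card ?C"
    using finite_subset[OF cluster_subset fin] by (meson card_image_le card_mono finite_imageI order_trans)
  then show ?thesis by simp
qed

text \<open>A union bound over the first vertex \<open>x\<close>. The origin is listed as a root
  although it is forbidden: the cluster is unchanged, but \<open>x\<close> gets the neighbour in the
  root set that \<open>hit_mult_weight_le\<close> demands.\<close>

lemma measure_reaches_bdry_le_hit:
  fixes P :: "(int ^ 'd) set pmf"
  assumes "set_pmf P \<subseteq> Pow (nbrs 0)"
  shows "measure (config_measure P) (reaches_bdry n) \<le>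
    (\<Sum>x\<in>nbrs 0. hit P (bdry n) {0, x} (insert 0 (- ball1 (Suc n))))"
proof -
  interpret prob_space "config_measure P" by (rule prob_space_config)
  let ?E = "insert 0 (- ball1 (Suc n) :: (int ^ 'd) set)"
  let ?A = "\<lambda>x. {\<omega>. cluster ?E {x} \<omega> \<inter> bdry n \<noteq> {}}"
  have A: "?A x \<in> events" for x
  proof -
    have "?A x = space (config_measure P) - {\<omega>. cluster ?E {x} \<omega> \<subseteq> - bdry n}" by auto
    then show ?thesis using sets_cluster_subset by (metis sets.compl_sets)
  qed
  have hit: "prob (?A x) = hit P (bdry n) {0, x} ?E" for x
  proof -
    have "cluster ?E {0, x} \<omega> = cluster ?E {x} \<omega>" for \<omega> by (auto simp: cluster_def)
    then have "hit P (bdry n) {0, x} ?E = (\<integral>\<omega>. indicator (?A x) \<omega> \<partial>config_measure P)"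
      unfolding hit_def by (intro Bochner_Integration.integral_cong) (auto simp: indicator_def)
    then show ?thesis using A by simp
  qed
  have "prob (reaches_bdry n) \<le> prob (\<Union>x\<in>nbrs 0. ?A x)"
  proof (rule finite_measure_mono_AE)
    show "AE \<omega> in config_measure P. \<omega> \<in> reaches_bdry n \<longrightarrow> \<omega> \<in> (\<Union>x\<in>nbrs 0. ?A x)"
      using AE_config_nbrs[OF assms] by eventually_elim (use reaches_bdry_imp_cluster in blast)
  qed (use A finite_nbrs_0 in \<open>intro sets.finite_UN, auto\<close>)
  also have "\<dots> \<le> (\<Sum>x\<in>nbrs 0. prob (?A x))"
    using A finite_nbrs_0 by (intro finite_measure_subadditive_finite) auto
  finally show ?thesis by (simp add: hit)
qed

lemma hit_weight_bdry_le:
  fixes Q :: "(int ^ 'd) set pmf"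
  assumes Q: "set_pmf Q \<subseteq> Pow (nbrs 0)" and "x \<in> nbrs 0" and fin: "finite (- E)" and "0 \<in> E" "0 \<le> h"
  shows "hit_weight Q h (bdry n) {0, x} E \<le> exp (- h * real n)"
proof -
  interpret prob_space "config_measure Q" by (rule prob_space_config)
  have cl: "cluster E {0, x} \<omega> = cluster E {x} \<omega>" for \<omega>
    using \<open>0 \<in> E\<close> by (auto simp: cluster_def)
  have "AE \<omega> in config_measure Q. of_bool (cluster E {0, x} \<omega> \<inter> bdry n \<noteq> {}) *
      exp (- h * real (card (cluster E {0, x} \<omega>))) \<le> exp (- h * real n)"
    using AE_config_nbrs[OF Q]
  proof eventually_elim
    case (elim \<omega>)
    then show ?case
      using card_cluster_ge[of \<omega> x E n] assms
      by (cases "cluster E {x} \<omega> \<inter> bdry n = {}") (auto simp: cl mult_left_mono)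
  qed
  then show ?thesis
    unfolding hit_weight_def
    by (intro integral_le_const
        integrable_cluster[OF fin, where f = "\<lambda>C. of_bool (C \<inter> bdry n \<noteq> {}) * exp (- h * real (card C))"])
qed

text \<open>With positive probability \<open>N(o) \<subseteq> {x}\<close> and \<open>N(x) \<subseteq> {o}\<close> for a fixed neighbour \<open>x\<close> of \<open>o\<close>.\<close>
lemma measure_reaches_bdry_less_1:
  fixes P :: "(int ^ 'd) set pmf"
  assumes miss: "\<And>A. A \<subset> nbrs 0 \<Longrightarrow> measure_pmf.prob P {S. S \<inter> A \<noteq> {}} < 1"
    and P: "set_pmf P \<subseteq> Pow (nbrs 0)"
  obtains d where "0 < d" "\<And>n. 1 \<le> n \<Longrightarrow> measure (config_measure P) (reaches_bdry n) \<le> 1 - d"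
proof -
  obtain i :: 'd where True by blast
  define x :: "int ^ 'd" where "x = axis i 1"
  have norm_x: "norm1 x = 1"
    by (simp add: x_def norm1_def axis_def if_distrib[of abs] cong: if_cong)
  then have x: "x \<in> nbrs 0" "- x \<in> nbrs 0" "x \<noteq> 0"
    by (auto simp: nbrs_def norm1_minus norm1_def)
  \<comment> \<open>Apply \<open>miss\<close> to all neighbours except \<open>y\<close>.\<close>
  have pos: "0 < measure_pmf.prob P {S. S \<subseteq> {y}}" if "y \<in> nbrs 0" for y
  proof -
    have "measure_pmf.prob P {S. S \<inter> (nbrs 0 - {y}) \<noteq> {}} < 1"
      using that by (intro miss) auto
    moreover have "measure_pmf.prob P {S. S \<subseteq> {y}} = measure_pmf.prob P (UNIV - {S. S \<inter> (nbrs 0 - {y}) \<noteq> {}})"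
      using P by (intro measure_pmf.finite_measure_eq_AE) (auto simp: AE_measure_pmf_iff)
    ultimately show ?thesis
      using measure_pmf.prob_compl[of "{S. S \<inter> (nbrs 0 - {y}) \<noteq> {}}" P] by simp
  qed
  interpret C: prob_space "config_measure P" by (rule prob_space_config)
  interpret product_prob_space "local_law P" UNIV ..
  define F :: "int ^ 'd \<Rightarrow> (int ^ 'd) set set" where "F u = (if u = 0 then {S. S \<subseteq> {x}} else {S. S \<subseteq> {0}})" for u
  define G :: "(int ^ 'd \<Rightarrow> (int ^ 'd) set) set" where "G = {\<omega>. \<omega> 0 \<subseteq> {x} \<and> \<omega> x \<subseteq> {0}}"
  have G: "G = prod_emb UNIV (local_law P) {0, x} (\<Pi>\<^sub>E u\<in>{0, x}. F u)"
    using x by (auto simp: G_def F_def prod_emb_def)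
  have G_sets: "G \<in> C.events"
    unfolding G config_measure_def by (intro sets_PiM_I) auto
  have "C.prob G = (\<Prod>u\<in>{0, x}. measure (local_law P u) (F u))"
    unfolding G config_measure_def by (rule measure_PiM_emb) auto
  also have "\<dots> = measure_pmf.prob P {S. S \<subseteq> {x}} * measure_pmf.prob P {S. S \<subseteq> {- x}}"
  proof -
    have "(+) x ` S \<subseteq> {0} \<longleftrightarrow> S \<subseteq> {- x}" for S
      by (auto simp: add_eq_0_iff)
    then show ?thesis using x by (simp add: F_def vimage_def)
  qed
  finally have "0 < C.prob G" using pos x by simp
  moreover have "C.prob (reaches_bdry n) \<le> 1 - C.prob G" if n: "1 \<le> n" for n
  proof -
    have "\<omega> \<notin> reaches_bdry n" if "\<omega> \<in> G" for \<omega>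
    proof
      assume "\<omega> \<in> reaches_bdry n"
      then obtain v where v: "v \<in> cluster {} {0} \<omega>" "v \<in> bdry n"
        by (auto simp: reaches_bdry_def reachable_eq_cluster)
      from v(1) have "v = 0 \<or> v = x"
        by (induction rule: cluster_induct) (use that in \<open>auto simp: G_def\<close>)
      moreover have "norm1 (0 :: int ^ 'd) = 0" by (simp add: norm1_def)
      ultimately show False using v(2) n norm_x by (auto simp: bdry_def ball1_def)
    qed
    then have "C.prob (reaches_bdry n) \<le> C.prob (space (config_measure P) - G)"
      using sets.compl_sets[OF G_sets] by (intro C.finite_measure_mono) auto
    then show ?thesis using C.prob_compl[OF G_sets] by simp
  qed
  ultimately show thesis using that by blast
qed

text \<open>For large \<open>n\<close> half of the rate \<open>h\<close> absorbs \<open>K\<close>;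
  for the finitely many smaller \<open>n\<close> the uniform gap \<open>d\<close> is used through
  \<open>1 - d \<le> 1 - c * n \<le> exp (- c * n)\<close>.\<close>

lemma exp_bound_absorb_constant:
  fixes p :: "nat \<Rightarrow> real"
  assumes "0 < h" "0 < d" "0 < K" and exp: "\<And>n. p n \<le> K * exp (- h * real n)"
    and le: "\<And>n. 1 \<le> n \<Longrightarrow> p n \<le> 1 - d" and "p 0 \<le> 1"
  shows "\<exists>c>0. \<forall>n. p n \<le> exp (- c * real n)"
proof -
  \<comment> \<open>From \<open>m\<close> on, \<open>K \<le> exp (h * n / 2)\<close>; the added 1
    makes \<open>m\<close> positive, so that \<open>d / m\<close> is meaningful.\<close>
  define m where "m = nat \<lceil>2 * ln K / h\<rceil> + 1"
  define c where "c = min (h / 2) (d / real m)"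
  have m: "1 \<le> m" by (simp add: m_def)
  have "2 * ln K / h \<le> real m" unfolding m_def by linarith
  then have K: "ln K \<le> h / 2 * real m" using assms(1) by (simp add: field_simps)
  have c: "0 < c" "c \<le> h / 2" "c \<le> d / real m"
    unfolding c_def using assms m by (simp_all only: min.cobounded1 min.cobounded2) auto
  have "p n \<le> exp (- c * real n)" for n
  proof -
    consider "n = 0" | "1 \<le> n" "n < m" | "m \<le> n" by linarith
    then show ?thesis
    proof cases
      case 2
      have "c * real n \<le> d / real m * real m" using c 2 by (intro mult_mono) auto
      then have "1 - d \<le> 1 + - c * real n" using m by simp
      also have "\<dots> \<le> exp (- c * real n)" by (rule exp_ge_add_one_self)
      finally show ?thesis using le[OF 2(1)] by simp
    next
      case 3
      have "h / 2 * real m \<le> h / 2 * real n" "c * real n \<le> h / 2 * real n"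
        using 3 c assms(1) by (intro mult_left_mono mult_right_mono; simp)+
      then have "ln K - h * real n \<le> - c * real n" using K by simp
      then have "exp (ln K - h * real n) \<le> exp (- c * real n)" by simp
      moreover have "exp (ln K - h * real n) = K * exp (- h * real n)"
        using assms(3) by (simp add: exp_diff exp_minus field_simps)
      ultimately show ?thesis using exp[of n] by linarith
    qed (use assms in simp)
  qed
  then show ?thesis using c by blast
qed

theorem theorem2p3:
  fixes P Q :: "(int ^ 'd) set pmf"
  assumes "set_pmf P \<subseteq> Pow (nbrs 0)"
    and "set_pmf Q \<subseteq> Pow (nbrs 0)"
    and "\<And>A. {} \<subset> A \<Longrightarrow> A \<subset> nbrs 0 \<Longrightarrow>
           measure_pmf.prob P {S. S \<inter> A \<noteq> {}} < measure_pmf.prob Q {S. S \<inter> A \<noteq> {}}"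
    and "measure (config_measure Q) percolates = 0"
  shows "\<exists>c>0. \<forall>n::nat. measure (config_measure P) (reaches_bdry n) \<le> exp (- c * real n)"
proof -
  obtain b where b: "0 \<le> b" "b < 1" and PQ: "\<And>A. A \<subset> nbrs 0 \<Longrightarrow>
      measure_pmf.prob P {S. S \<inter> A \<noteq> {}} \<le> b * measure_pmf.prob Q {S. S \<inter> A \<noteq> {}}"
    using uniform_strict_ratio[OF assms(3)] by blast
  obtain h where h: "0 < h" and half: "\<And>x F. finite (- F) \<Longrightarrow> 1 / 2 \<le> weight Q h {x} F"
    and w: "\<And>R E u S. finite (- E) \<Longrightarrow> S \<subseteq> nbrs 0 \<Longrightarrow> b * weight Q h R E \<le> weight Q h (R \<union> (+) u ` S) E"
    using ex_weight_Un_ge[OF assms(4) b] by blast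
  have miss: "measure_pmf.prob P {S. S \<inter> A \<noteq> {}} < 1" if "A \<subset> nbrs 0" for A
  proof -
    have "b * measure_pmf.prob Q {S. S \<inter> A \<noteq> {}} \<le> b * 1"
      using b by (intro mult_left_mono) auto
    then show ?thesis using PQ[OF that] b by linarith
  qed
  obtain d where d: "0 < d" "\<And>n. 1 \<le> n \<Longrightarrow> measure (config_measure P) (reaches_bdry n) \<le> 1 - d"
    using measure_reaches_bdry_less_1[OF miss assms(1)] by blast
  define D where "D = real (card (nbrs 0 :: (int ^ 'd) set))"
  have hit: "hit P (bdry n) {0, x} (insert 0 (- ball1 (Suc n))) \<le> 2 * exp (- h * real n)"
    if x: "x \<in> nbrs 0" for n x
  proof -
    let ?E = "insert 0 (- ball1 (Suc n) :: (int ^ 'd) set)"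
    have fin: "finite (- ?E)" by (rule finite_subset[OF _ finite_ball1[of "Suc n"]]) auto
    have "{0, x} \<inter> (+) u ` nbrs 0 \<noteq> {}" if "u \<in> {0, x} - ?E" for u
    proof -
      have "- x \<in> nbrs 0" using x by (simp add: nbrs_def norm1_minus)
      then have "x + - x \<in> (+) x ` nbrs 0" by blast
      then show ?thesis using that by auto
    qed
    then have "hit P (bdry n) {0, x} ?E * weight Q h {0, x} ?E \<le> hit_weight Q h (bdry n) {0, x} ?E"
      using h b by (intro hit_mult_weight_le[where b = b] finite_nbrs_0 assms PQ w fin) auto
    also have "\<dots> \<le> exp (- h * real n)"
      using h x by (intro hit_weight_bdry_le assms fin) auto
    finally have "hit P (bdry n) {0, x} ?E * weight Q h {0, x} ?E \<le> exp (- h * real n)" .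
    moreover have "cluster ?E {0, x} \<omega> = cluster ?E {x} \<omega>" for \<omega> by (auto simp: cluster_def)
    then have "1 / 2 \<le> weight Q h {0, x} ?E"
      using half[OF fin, of x] by (simp add: weight_def)
    \<comment> \<open>Dividing by the normalising constant, which is at least 1/2, costs only the
      factor 2.\<close>
    then have "hit P (bdry n) {0, x} ?E * (1 / 2) \<le> hit P (bdry n) {0, x} ?E * weight Q h {0, x} ?E"
      using hit_bounds(1) by (rule mult_left_mono)
    ultimately show ?thesis by linarith
  qed
  have bound: "measure (config_measure P) (reaches_bdry n) \<le> (2 * D + 1) * exp (- h * real n)" for n
  proof -
    have "measure (config_measure P) (reaches_bdry n) \<le> D * (2 * exp (- h * real n))"
      using measure_reaches_bdry_le_hit[OF assms(1), of n]
        sum_bounded_above[of "nbrs 0", OF hit] unfolding D_def by (rule order_trans)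
    also have "\<dots> \<le> (2 * D + 1) * exp (- h * real n)" by (simp add: algebra_simps)
    finally show ?thesis .
  qed
  show ?thesis
  proof (rule exp_bound_absorb_constant[OF h d(1) _ bound d(2)])
    show "0 < 2 * D + 1" by (simp add: D_def add_nonneg_pos)
    show "measure (config_measure P) (reaches_bdry 0) \<le> 1"
      by (rule prob_space.prob_le_1[OF prob_space_config])
  qed
qed

end
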